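(* Let $M=(X,d)$ be a quasimetric space and let $\beta>0$. Suppose that $M$ admits a random embedding into quasiultrametric spaces with distortion $\beta$. Then for any $r>0$ there exists a $\beta$-Lipschitz distribution over $r$-bounded quasipartitions of $M$.
   Context: A quasimetric space is a pair $(X,d)$ with $d:X\times X\to\mathbb{R}_{\ge 0}\cup\{+\infty\}$, $d(x,y)=0$ iff $x=y$, and $d(x,y)\le d(x,z)+d(z,y)$ (no symmetry required). A quasiultrametric space additionally satisfies $d(x,y)\le\max\{d(x,z),d(z,y)\}$. A random embedding of $M$ into quasiultrametric spaces is a distribution over pairs $(f,M')$, $M'=(X',d')$ quasiultrametric, $f:X\to X'$, with $d'(f(x),f(y))\ge d(x,y)$ almost surely; it has distortion $\beta$ if $\mathbb{E}[d'(f(x),f(y))]\le\beta\,d(x,y)$ for all $x,y$. A quasipartition of $X$ is a reflexive transitive relation $P\subseteq X\times X$; it is $r$-bounded if $(x,y)\in P$ implies $d(x,y)\le r$; a distribution over $r$-bounded quasipartitions is $\beta$-Lipschitz if $\Pr[(x,y)\notin P]\le\beta\,d(x,y)/r$ for all $x,y$. *)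

theory Defs
  imports "HOL-Probability.Probability"
begin

locale quasimetric_space =
  fixes X :: "'a set" and d :: "'a \<Rightarrow> 'a \<Rightarrow> ennreal"
  assumes zero_iff: "\<lbrakk>x \<in> X; y \<in> X\<rbrakk> \<Longrightarrow> d x y = 0 \<longleftrightarrow> x = y"
    and triangle: "\<lbrakk>x \<in> X; y \<in> X; z \<in> X\<rbrakk> \<Longrightarrow> d x y \<le> d x z + d z y"

locale quasiultrametric_space = quasimetric_space +
  assumes ultra: "\<lbrakk>x \<in> X; y \<in> X; z \<in> X\<rbrakk> \<Longrightarrow> d x y \<le> max (d x z) (d z y)"

text \<open>A sample is a triple \<open>(f, X', d')\<close>; the target carriers \<open>X'\<close> may vary with the sample
  inside the type \<open>'b\<close>. The sigma-algebra of \<open>D\<close> is arbitrary, subject only to the target distances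
  being random variables. Non-contraction is required almost surely for each pair of points
  separately, which for uncountable \<open>X\<close> is weaker than almost surely for all pairs at once.\<close>

definition random_quasiultrametric_embedding ::
  "'a set \<Rightarrow> ('a \<Rightarrow> 'a \<Rightarrow> ennreal) \<Rightarrow>
    (('a \<Rightarrow> 'b) \<times> 'b set \<times> ('b \<Rightarrow> 'b \<Rightarrow> ennreal)) measure \<Rightarrow> bool" where
  "random_quasiultrametric_embedding X d D \<longleftrightarrow>
     prob_space D \<and>
     (\<forall>(f, X', d') \<in> space D. quasiultrametric_space X' d' \<and> f \<in> X \<rightarrow> X') \<and>
     (\<forall>x\<in>X. \<forall>y\<in>X. (\<lambda>(f, X', d'). d' (f x) (f y)) \<in> borel_measurable D) \<and>
     (\<forall>x\<in>X. \<forall>y\<in>X. AE (f, X', d') in D. d x y \<le> d' (f x) (f y))"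

definition has_distortion ::
  "'a set \<Rightarrow> ('a \<Rightarrow> 'a \<Rightarrow> ennreal) \<Rightarrow>
    (('a \<Rightarrow> 'b) \<times> 'b set \<times> ('b \<Rightarrow> 'b \<Rightarrow> ennreal)) measure \<Rightarrow> real \<Rightarrow> bool" where
  "has_distortion X d D \<beta> \<longleftrightarrow>
     (\<forall>x\<in>X. \<forall>y\<in>X. (\<integral>\<^sup>+ (f, X', d'). d' (f x) (f y) \<partial>D) \<le> ennreal \<beta> * d x y)"

definition quasipartition :: "'a set \<Rightarrow> ('a \<times> 'a) set \<Rightarrow> bool" where
  "quasipartition X P \<longleftrightarrow> P \<subseteq> X \<times> X \<and> refl_on X P \<and> trans P"

definition bounded_relation ::
  "('a \<Rightarrow> 'a \<Rightarrow> ennreal) \<Rightarrow> real \<Rightarrow> ('a \<times> 'a) set \<Rightarrow> bool" where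
  "bounded_relation d r P \<longleftrightarrow> (\<forall>(x, y) \<in> P. d x y \<le> ennreal r)"

text \<open>As above, the sigma-algebra is arbitrary, provided that the events \<open>(x, y) \<notin> P\<close> are
  measurable.\<close>

definition bounded_quasipartition_distribution ::
  "'a set \<Rightarrow> ('a \<Rightarrow> 'a \<Rightarrow> ennreal) \<Rightarrow> real \<Rightarrow> ('a \<times> 'a) set measure \<Rightarrow> bool" where
  "bounded_quasipartition_distribution X d r Q \<longleftrightarrow>
     prob_space Q \<and>
     (\<forall>P \<in> space Q. quasipartition X P \<and> bounded_relation d r P) \<and>
     (\<forall>x\<in>X. \<forall>y\<in>X. {P \<in> space Q. (x, y) \<notin> P} \<in> sets Q)"

definition lipschitz_quasipartition_distribution ::
  "'a set \<Rightarrow> ('a \<Rightarrow> 'a \<Rightarrow> ennreal) \<Rightarrow> real \<Rightarrow> real \<Rightarrow> ('a \<times> 'a) set measure \<Rightarrow> bool" where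
  "lipschitz_quasipartition_distribution X d r \<beta> Q \<longleftrightarrow>
     (\<forall>x\<in>X. \<forall>y\<in>X. emeasure Q {P \<in> space Q. (x, y) \<notin> P} \<le> ennreal \<beta> * d x y / ennreal r)"

end

theory Submission
  imports Defs
begin

text \<open>
  Given a sample \<open>(f, X', d')\<close>, the relation \<open>d' (f x) (f y) \<le> r\<close> is reflexive and, by the
  ultrametric inequality, transitive; Markov's inequality bounds the probability that a pair is
  missing from it. For uncountable \<open>X\<close> this relation need not be \<open>r\<close>-bounded for any sample, since
  non-contraction only holds almost surely for each pair. However, an event generated by the
  coordinates \<open>(x, y) \<notin> P\<close> depends on countably many pairs only, and almost surely the random relation
  agrees on these pairs with an \<open>r\<close>-bounded quasipartition. So the \<open>r\<close>-bounded quasipartitions have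
  outer measure one under its law, which therefore has a trace on them.
\<close>

text \<open>If a measurable \<open>C\<close> covers \<open>A \<inter> K\<close>, then the complement
  of \<open>A - C\<close> is measurable and contains \<open>K\<close>, so by \<open>full\<close> it
  carries the whole mass. Hence \<open>A - C\<close> is null, and \<open>C\<close> has at least the
  measure of \<open>A\<close>.\<close>

lemma outer_measure_of_Int_full:
  assumes N: "finite_measure N" and K: "K \<subseteq> space N"
    and full: "\<And>A. A \<in> sets N \<Longrightarrow> K \<subseteq> A \<Longrightarrow> emeasure N A = emeasure N (space N)"
    and A: "A \<in> sets N"
  shows "outer_measure_of N (A \<inter> K) = emeasure N A"
proof (rule antisym)
  show "outer_measure_of N (A \<inter> K) \<le> emeasure N A"
    unfolding outer_measure_of_def using A by (intro INF_lower) auto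
  show "emeasure N A \<le> outer_measure_of N (A \<inter> K)"
    unfolding outer_measure_of_def
  proof (rule INF_greatest)
    interpret finite_measure N by (rule N)
    fix C assume "C \<in> {B \<in> sets N. A \<inter> K \<subseteq> B}"
    then have C: "C \<in> sets N" "A \<inter> K \<subseteq> C" by auto
    let ?B = "space N - (A - C)"
    have "K \<subseteq> ?B" using K C by auto
    then have "emeasure N ?B = emeasure N (space N)"
      using A C by (intro full) auto
    then have "measure N (A - C) = 0"
      using finite_measure_compl[of "A - C"] A C by (simp add: measure_def)
    then have "emeasure N (A - C) = 0"
      by (simp add: emeasure_eq_measure)
    then have "A - C \<in> null_sets N" using A C by (auto simp: null_sets_def)
    then have "emeasure N (C \<union> (A - C)) = emeasure N C"
      using C by (intro emeasure_Un_null_set)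
    moreover have "emeasure N A \<le> emeasure N (C \<union> (A - C))"
      using A C by (intro emeasure_mono) auto
    ultimately show "emeasure N A \<le> emeasure N C" by simp
  qed
qed

text \<open>This passes from a law \<open>N\<close> to one living on \<open>K\<close> when
  \<open>K\<close> is perhaps not measurable but has full outer measure: on the traces
  \<open>A \<inter> K\<close> the outer measure agrees with \<open>emeasure N A\<close>, and this
  makes it countably additive there.\<close>

lemma trace_measure_exists:
  assumes N: "finite_measure N" and K: "K \<subseteq> space N"
    and full: "\<And>A. A \<in> sets N \<Longrightarrow> K \<subseteq> A \<Longrightarrow> emeasure N A = emeasure N (space N)"
  obtains Q where "space Q = K" "\<And>A. A \<in> sets N \<Longrightarrow> A \<inter> K \<in> sets Q"
    "\<And>A. A \<in> sets N \<Longrightarrow> emeasure Q (A \<inter> K) = emeasure N A"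
proof
  have outer: "outer_measure_of N (A \<inter> K) = emeasure N A" if "A \<in> sets N" for A
    using assms that by (rule outer_measure_of_Int_full)
  \<comment> \<open>Only the sigma-algebra of \<open>restrict_space N K\<close> is used. Its own
    measure comes from \<open>emeasure N\<close>, which is 0 on sets outside \<open>sets N\<close>,
    so the outer measure takes its place.\<close>
  define Q where "Q = measure_of K (sets (restrict_space N K)) (outer_measure_of N)"
  have spK: "space (restrict_space N K) = K" using K by (auto simp: space_restrict_space)
  have sub: "sets (restrict_space N K) \<subseteq> Pow K"
    using sets.space_closed[of "restrict_space N K"] spK by simp
  show "space Q = K" unfolding Q_def by (rule space_measure_of[OF sub])
  have sQ: "sets Q = sets (restrict_space N K)"
    unfolding Q_def using sub sets.sigma_sets_eq[of "restrict_space N K"] spK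
    by (simp add: sets_measure_of)
  show AQ: "A \<inter> K \<in> sets Q" if "A \<in> sets N" for A
    using that by (auto simp: sQ sets_restrict_space)
  have "positive (sets Q) (outer_measure_of N)"
    using outer[of "{}"] by (simp add: positive_def)
  moreover have "countably_additive (sets Q) (outer_measure_of N)"
    unfolding countably_additive_def
  proof (intro allI impI)
    fix B :: "nat \<Rightarrow> _" assume B: "range B \<subseteq> sets Q" and dis: "disjoint_family B"
    have "\<forall>i. \<exists>A. A \<in> sets N \<and> B i = A \<inter> K"
    proof
      fix i
      have "B i \<in> sets (restrict_space N K)" using B by (auto simp: sQ)
      then show "\<exists>A. A \<in> sets N \<and> B i = A \<inter> K" by (auto simp: sets_restrict_space)
    qed
    then obtain A where A: "\<And>i. A i \<in> sets N" "\<And>i. B i = A i \<inter> K" by metis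
    \<comment> \<open>The sets \<open>B i\<close> are disjoint, but the chosen \<open>A i\<close>
      may overlap outside \<open>K\<close>. Removing the earlier ones from each \<open>A i\<close>
      makes them disjoint and leaves the traces on \<open>K\<close> unchanged.\<close>
    have dA: "disjointed A i \<in> sets N" for i
      using A sets.range_disjointed_sets[of A N] by auto
    have dB: "disjointed A i \<inter> K = B i" for i
    proof -
      have "B i \<inter> B j = {}" if "j \<in> {0..<i}" for j
        using dis that by (intro disjoint_family_onD[of B UNIV]) auto
      then show ?thesis unfolding disjointed_def A(2) by blast
    qed
    have "(\<Sum>i. outer_measure_of N (B i)) = (\<Sum>i. emeasure N (disjointed A i))"
      using outer[OF dA] dB by simp
    also have "\<dots> = emeasure N (\<Union>i. disjointed A i)"
      using dA by (intro suminf_emeasure disjoint_family_disjointed) auto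
    also have "\<dots> = outer_measure_of N ((\<Union>i. disjointed A i) \<inter> K)"
      using dA by (intro outer[symmetric]) auto
    also have "(\<Union>i. disjointed A i) \<inter> K = (\<Union>i. B i)"
      using dB by auto
    finally show "(\<Sum>i. outer_measure_of N (B i)) = outer_measure_of N (\<Union>i. B i)" .
  qed
  ultimately show "emeasure Q (A \<inter> K) = emeasure N A" if "A \<in> sets N" for A
    using that AQ[OF that] outer[OF that] sub
    by (subst emeasure_measure_of[OF Q_def]) auto
qed

text \<open>The sets whose membership depends on countably many coordinates form a sigma-algebra: a
  complement keeps the same \<open>J\<close>, and a countable union of sets uses the union of their
  \<open>J\<close>. Each generator depends on a single coordinate.\<close>

lemma sigma_sets_countably_determined:
  assumes "A \<in> sigma_sets (Pow S) ((\<lambda>s. {P \<in> Pow S. s \<notin> P}) ` S)"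
  shows "\<exists>J\<subseteq>S. countable J \<and> (\<forall>P\<in>Pow S. \<forall>P'\<in>Pow S. P \<inter> J = P' \<inter> J \<longrightarrow> (P \<in> A \<longleftrightarrow> P' \<in> A))"
  using assms
proof induction
  case (Basic a)
  then obtain s where "s \<in> S" "a = {P \<in> Pow S. s \<notin> P}" by auto
  then show ?case by (intro exI[of _ "{s}"]) auto
next
  case Empty
  show ?case by auto
next
  case (Compl a)
  then obtain J where "J \<subseteq> S" "countable J"
    "\<forall>P\<in>Pow S. \<forall>P'\<in>Pow S. P \<inter> J = P' \<inter> J \<longrightarrow> (P \<in> a \<longleftrightarrow> P' \<in> a)" by blast
  then show ?case by (intro exI[of _ J]) (simp only: Diff_iff, blast)
next
  case (Union a)
  then have "\<forall>i. \<exists>J\<subseteq>S. countable J \<and>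
      (\<forall>P\<in>Pow S. \<forall>P'\<in>Pow S. P \<inter> J = P' \<inter> J \<longrightarrow> (P \<in> a i \<longleftrightarrow> P' \<in> a i))" by blast
  then obtain J where "\<forall>i. J i \<subseteq> S \<and> countable (J i) \<and>
      (\<forall>P\<in>Pow S. \<forall>P'\<in>Pow S. P \<inter> J i = P' \<inter> J i \<longrightarrow> (P \<in> a i \<longleftrightarrow> P' \<in> a i))"
    by (rule choice[THEN exE])
  then have J: "\<And>i. J i \<subseteq> S" "\<And>i. countable (J i)"
    "\<And>i P P'. P \<in> Pow S \<Longrightarrow> P' \<in> Pow S \<Longrightarrow> P \<inter> J i = P' \<inter> J i \<Longrightarrow> P \<in> a i \<longleftrightarrow> P' \<in> a i"
    by blast+
  have det: "P \<in> \<Union> (range a) \<longleftrightarrow> P' \<in> \<Union> (range a)"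
    if "P \<in> Pow S" "P' \<in> Pow S" "P \<inter> (\<Union>i. J i) = P' \<inter> (\<Union>i. J i)" for P P'
  proof -
    have "P \<inter> J i = P' \<inter> J i" for i using that(3) by blast
    then have "P \<in> a i \<longleftrightarrow> P' \<in> a i" for i by (rule J(3)[OF that(1,2)])
    then show ?thesis by simp
  qed
  show ?case
  proof (intro exI[of _ "\<Union>i. J i"] conjI ballI impI)
    show "(\<Union>i. J i) \<subseteq> S" using J(1) by (rule UN_least)
    show "countable (\<Union>i. J i)" using J(2) by simp
  qed (rule det)
qed

lemma quasipartition_ultrametric_threshold:
  assumes "quasiultrametric_space X' d'" "f \<in> X \<rightarrow> X'"
  shows "quasipartition X {(x, y) \<in> X \<times> X. d' (f x) (f y) \<le> ennreal r}"
proof -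
  interpret quasiultrametric_space X' d' by (rule assms)
  have fX: "x \<in> X \<Longrightarrow> f x \<in> X'" for x using assms(2) by auto
  have "trans {(x, y) \<in> X \<times> X. d' (f x) (f y) \<le> ennreal r}"
  proof (rule transI)
    fix x y z
    assume *: "(x, y) \<in> {(x, y) \<in> X \<times> X. d' (f x) (f y) \<le> ennreal r}"
      "(y, z) \<in> {(x, y) \<in> X \<times> X. d' (f x) (f y) \<le> ennreal r}"
    then have "d' (f x) (f z) \<le> max (d' (f x) (f y)) (d' (f y) (f z))"
      by (intro ultra fX) auto
    also have "\<dots> \<le> ennreal r" using * by simp
    finally show "(x, z) \<in> {(x, y) \<in> X \<times> X. d' (f x) (f y) \<le> ennreal r}"
      using * by simp
  qed
  moreover have "d' (f x) (f x) = 0" if "x \<in> X" for x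
    using zero_iff fX that by simp
  ultimately show ?thesis by (auto simp: quasipartition_def refl_on_def)
qed

text \<open>This supplies quasipartitions whose boundedness needs checking only on
  \<open>J \<times> J\<close>. Transitivity survives because two composable off-diagonal pairs have
  all their points in \<open>J\<close>.\<close>

lemma quasipartition_restrict:
  assumes "quasipartition X P"
  shows "quasipartition X (P \<inter> J \<times> J \<union> Id_on X)"
  using assms unfolding quasipartition_def refl_on_def trans_def by blast

theorem theorem20:
  fixes X :: "'a set" and d :: "'a \<Rightarrow> 'a \<Rightarrow> ennreal" and \<beta> :: real
    and D :: "(('a \<Rightarrow> 'b) \<times> 'b set \<times> ('b \<Rightarrow> 'b \<Rightarrow> ennreal)) measure"
  assumes "quasimetric_space X d"
    and "\<beta> > 0"
    and "random_quasiultrametric_embedding X d D"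
    and "has_distortion X d D \<beta>"
  shows "\<forall>r::real. r > 0 \<longrightarrow>
    (\<exists>Q :: ('a \<times> 'a) set measure.
       bounded_quasipartition_distribution X d r Q \<and>
       lipschitz_quasipartition_distribution X d r \<beta> Q)"
proof (intro allI impI)
  fix r :: real assume r: "r > 0"
  interpret quasimetric_space X d by (rule assms(1))
  define \<delta> where "\<delta> x y = (\<lambda>(f :: 'a \<Rightarrow> 'b, X' :: 'b set, d'). d' (f x) (f y) :: ennreal)" for x y :: 'a
  define \<phi> where "\<phi> \<omega> = {(x, y) \<in> X \<times> X. \<delta> x y \<omega> \<le> ennreal r}" for \<omega>
  \<comment> \<open>\<open>K\<close> need not be an event of the sigma-algebra generated by
    \<open>G\<close>: reflexivity alone already constrains every diagonal pair, and there may be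
    uncountably many.\<close>
  define K where "K = {P. quasipartition X P \<and> bounded_relation d r P}"
  define G where "G = (\<lambda>s. {P \<in> Pow (X \<times> X). s \<notin> P}) ` (X \<times> X)"
  \<comment> \<open>\<open>N\<close> is the law of the threshold relation on all subsets of
    \<open>X \<times> X\<close>. Generating its sigma-algebra by \<open>G\<close> alone keeps every
    event dependent on countably many pairs; the required distribution is the trace of
    \<open>N\<close> on \<open>K\<close>.\<close>
  define N where "N = distr D (sigma (Pow (X \<times> X)) G) \<phi>"
  interpret D: prob_space D
    using assms(3) by (simp add: random_quasiultrametric_embedding_def)
  have \<delta>_meas [measurable]: "\<delta> x y \<in> borel_measurable D" if "x \<in> X" "y \<in> X" for x y
    using assms(3) that unfolding random_quasiultrametric_embedding_def \<delta>_def by blast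
  have noncontr: "AE \<omega> in D. d x y \<le> \<delta> x y \<omega>" if "x \<in> X" "y \<in> X" for x y
    using assms(3) that unfolding random_quasiultrametric_embedding_def \<delta>_def
    by (simp add: case_prod_unfold)
  have dist: "(\<integral>\<^sup>+ \<omega>. \<delta> x y \<omega> \<partial>D) \<le> ennreal \<beta> * d x y" if "x \<in> X" "y \<in> X" for x y
    using assms(4) that unfolding has_distortion_def \<delta>_def by blast
  have \<phi>_quasi: "quasipartition X (\<phi> \<omega>)" if "\<omega> \<in> space D" for \<omega>
    using assms(3) that quasipartition_ultrametric_threshold[of _ _ _ X r]
    unfolding random_quasiultrametric_embedding_def \<phi>_def \<delta>_def
    by (cases \<omega>) fastforce
  have GPow: "G \<subseteq> Pow (Pow (X \<times> X))" by (auto simp: G_def)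
  have \<phi>_vimage: "\<phi> -` {P \<in> Pow (X \<times> X). (x, y) \<notin> P} \<inter> space D
      = {\<omega> \<in> space D. ennreal r < \<delta> x y \<omega>}" if "x \<in> X" "y \<in> X" for x y
    using that by (auto simp: \<phi>_def not_le)
  have \<phi>_meas: "\<phi> \<in> measurable D (sigma (Pow (X \<times> X)) G)"
  proof (rule measurable_measure_of[OF GPow])
    show "\<phi> \<in> space D \<rightarrow> Pow (X \<times> X)" by (auto simp: \<phi>_def)
    fix B assume "B \<in> G"
    then obtain x y where "x \<in> X" "y \<in> X" "B = {P \<in> Pow (X \<times> X). (x, y) \<notin> P}"
      by (auto simp: G_def)
    then show "\<phi> -` B \<inter> space D \<in> sets D" using \<phi>_vimage by simp
  qed
  have spN: "space N = Pow (X \<times> X)"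
    by (simp add: N_def space_measure_of[OF GPow])
  have setsN: "sets N = sigma_sets (Pow (X \<times> X)) G"
    by (simp add: N_def sets_measure_of[OF GPow])
  interpret N: prob_space N
    unfolding N_def by (rule D.prob_space_distr[OF \<phi>_meas])
  have full: "emeasure N A = emeasure N (space N)" if A: "A \<in> sets N" "K \<subseteq> A" for A
  proof -
    obtain J where J: "J \<subseteq> X \<times> X" "countable J"
      and det: "\<forall>P\<in>Pow (X \<times> X). \<forall>P'\<in>Pow (X \<times> X). P \<inter> J = P' \<inter> J \<longrightarrow> (P \<in> A \<longleftrightarrow> P' \<in> A)"
      using sigma_sets_countably_determined[OF A(1)[unfolded setsN G_def]] by (elim exE conjE)
    \<comment> \<open>\<open>I\<close> collects the points occurring in \<open>J\<close>. As it is
      countable, the almost sure non-contraction of each pair holds almost surely for all pairs from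
      \<open>I\<close> at once.\<close>
    define I where "I = fst ` J \<union> snd ` J"
    have I: "countable I" "I \<subseteq> X" "J \<subseteq> I \<times> I"
      using J by (auto simp: I_def intro: rev_image_eqI)
    have "AE \<omega> in D. \<forall>x\<in>I. \<forall>y\<in>I. d x y \<le> \<delta> x y \<omega>"
      using noncontr I by (auto simp: AE_ball_countable)
    then have "AE \<omega> in D. \<phi> \<omega> \<in> A"
    proof (rule AE_mp, intro AE_I2 impI)
      fix \<omega> assume \<omega>: "\<omega> \<in> space D" "\<forall>x\<in>I. \<forall>y\<in>I. d x y \<le> \<delta> x y \<omega>"
      \<comment> \<open>This relation lies in \<open>K\<close>: its pairs are diagonal, at distance
        0, or come from \<open>I \<times> I\<close>, where non-contraction turns the threshold on
        \<delta> into one on \<open>d\<close>.\<close>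
      let ?P = "\<phi> \<omega> \<inter> I \<times> I \<union> Id_on X"
      have "d x x \<le> ennreal r" if "x \<in> X" for x
        using zero_iff[of x x] that by simp
      moreover have "d x y \<le> ennreal r" if "(x, y) \<in> \<phi> \<omega> \<inter> I \<times> I" for x y
        using that \<omega>(2) by (auto simp: \<phi>_def intro: order_trans)
      ultimately have "bounded_relation d r ?P"
        by (auto simp: bounded_relation_def)
      then have "?P \<in> A"
        using A(2) quasipartition_restrict[OF \<phi>_quasi[OF \<omega>(1)]] by (auto simp: K_def)
      \<comment> \<open>The added diagonal changes nothing, since \<open>\<phi> \<omega>\<close> is
        reflexive, and the cut to \<open>I \<times> I\<close> removes no pair of
        \<open>J\<close>.\<close>
      moreover have "\<phi> \<omega> \<inter> J = ?P \<inter> J"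
        using \<phi>_quasi[OF \<omega>(1)] I(3) by (auto simp: quasipartition_def refl_on_def)
      ultimately show "\<phi> \<omega> \<in> A"
        using det[rule_format, of "\<phi> \<omega>" ?P] by (auto simp: \<phi>_def)
    qed
    then have "AE P in N. P \<in> A"
      unfolding N_def using A(1) by (subst AE_distr_iff[OF \<phi>_meas]) (auto simp: N_def)
    then show ?thesis
      using A(1) by (simp add: N.emeasure_eq_1_AE N.emeasure_space_1)
  qed
  have KN: "K \<subseteq> space N" by (auto simp: K_def quasipartition_def spN)
  obtain Q where Q: "space Q = K" "\<And>A. A \<in> sets N \<Longrightarrow> A \<inter> K \<in> sets Q"
    "\<And>A. A \<in> sets N \<Longrightarrow> emeasure Q (A \<inter> K) = emeasure N A"
    using trace_measure_exists[OF N.finite_measure_axioms KN full] by blast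
  have event: "{P \<in> space Q. s \<notin> P} = {P \<in> Pow (X \<times> X). s \<notin> P} \<inter> K" for s
    using KN by (auto simp: Q(1) spN)
  have GN: "{P \<in> Pow (X \<times> X). (x, y) \<notin> P} \<in> sets N" if "x \<in> X" "y \<in> X" for x y
    using that by (auto simp: setsN G_def)
  have "emeasure Q (space Q) = 1"
    using Q(3)[OF sets.top] KN by (simp add: Q(1) Int_absorb1 N.emeasure_space_1)
  then have "bounded_quasipartition_distribution X d r Q"
    using Q(2)[OF GN] by (auto simp: bounded_quasipartition_distribution_def event prob_spaceI)
      (auto simp: Q(1) K_def)
  moreover have "emeasure Q {P \<in> space Q. (x, y) \<notin> P} \<le> ennreal \<beta> * d x y / ennreal r"
    if xy: "x \<in> X" "y \<in> X" for x y
  proof -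
    have "emeasure Q {P \<in> space Q. (x, y) \<notin> P} = emeasure D {\<omega> \<in> space D. ennreal r < \<delta> x y \<omega>}"
      unfolding event Q(3)[OF GN[OF xy]] \<phi>_vimage[OF xy, symmetric]
      unfolding N_def using GN[OF xy] by (intro emeasure_distr[OF \<phi>_meas]) (simp add: N_def)
    \<comment> \<open>The event is rescaled to the form \<open>1 \<le> c * u\<close> of Markov's
      inequality, with \<open>c\<close> the inverse of \<open>r\<close>.\<close>
    also have "\<dots> \<le> emeasure D {\<omega> \<in> space D. 1 \<le> inverse (ennreal r) * \<delta> x y \<omega>}"
    proof (rule emeasure_mono)
      have "1 \<le> inverse (ennreal r) * t" if "ennreal r < t" for t
      proof -
        have "1 = inverse (ennreal r) * ennreal r"
          using r by (simp add: inverse_ennreal ennreal_mult[symmetric] flip: ennreal_1)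
        also have "\<dots> \<le> inverse (ennreal r) * t" using that by (intro mult_left_mono) auto
        finally show ?thesis .
      qed
      then show "{\<omega> \<in> space D. ennreal r < \<delta> x y \<omega>}
          \<subseteq> {\<omega> \<in> space D. 1 \<le> inverse (ennreal r) * \<delta> x y \<omega>}" by auto
    qed (use xy in measurable)
    also have "\<dots> \<le> inverse (ennreal r) * (\<integral>\<^sup>+ \<omega>. \<delta> x y \<omega> \<partial>D)"
      using nn_integral_Markov_inequality[of "\<delta> x y" "space D" D "inverse (ennreal r)"] xy
      by (simp cong: nn_integral_cong)
    also have "\<dots> \<le> inverse (ennreal r) * (ennreal \<beta> * d x y)"
      by (intro mult_left_mono dist xy) auto
    finally show ?thesis by (simp add: divide_ennreal_def mult.commute)
  qed
  ultimately show "\<exists>Q :: ('a \<times> 'a) set measure.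
       bounded_quasipartition_distribution X d r Q \<and>
       lipschitz_quasipartition_distribution X d r \<beta> Q"
    by (auto simp: lipschitz_quasipartition_distribution_def)
qed

end
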